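(* Let $E$ be a real vector space, let $f\colon E\to\mathbb{R}$ be convex, let $Z$ be a nonempty set, and let $j\colon Z\to E$ and $k\colon Z\to\mathbb{R}$ be maps. Suppose that, whenever $z_1,z_2\in Z$, there exists $z\in Z$ such that, for all real $\rho\ge 0$, $$f\big(\rho\big[j(z)-\tfrac12 j(z_1)-\tfrac12 j(z_2)\big]\big)+\rho\big[k(z)-\tfrac12 k(z_1)-\tfrac12 k(z_2)\big]\le f(0).$$ Then there exists an affine map $A\colon E\to\mathbb{R}$ such that $A\le f$ on $E$ and $$\inf_Z\big[A\circ j+k\big]=\inf_Z\big[f\circ j+k\big].$$
   Context: All vector spaces are real. "Convex" and "affine" have their usual senses; in particular an affine map $A\colon E\to\mathbb{R}$ is a linear functional plus a real constant. $A\le f$ on $E$ means $A(x)\le f(x)$ for all $x\in E$. Infima are taken in $[-\infty,\infty[$, i.e. the value $-\infty$ is allowed, and $\inf_Z g$ denotes $\inf_{z\in Z}g(z)$. *)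

theory Defs
  imports "HOL-Analysis.Analysis"
begin

definition affine_map :: "('a::real_vector \<Rightarrow> real) \<Rightarrow> bool" where
  "affine_map A \<longleftrightarrow> (\<exists>L c. linear L \<and> (\<forall>x. A x = L x + c))"

end

theory Submission
  imports Defs
begin

text \<open>
  The pair \<open>(j, k)\<close> enters through the marginal function \<open>g x = (INF z\<in>Z. f (j z + x) + k z)\<close>.
  The hypothesis, with its arbitrary \<open>\<rho> \<ge> 0\<close>, says that \<open>(w, - s)\<close>, where
  \<open>w = j z - j z1 / 2 - j z2 / 2\<close> and \<open>s = k z - k z1 / 2 - k z2 / 2\<close>, is a direction of
  recession of the epigraph of \<open>f\<close>. For a finite convex function the base point of a direction of
  recession is irrelevant, so \<open>f (x + w) + s \<le> f x\<close> for every \<open>x\<close> and not only for \<open>x = 0\<close>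
  (\<open>convex_recession_any_point\<close>). This makes \<open>g\<close> midpoint convex. As \<open>g\<close> also lies below the
  convex functions \<open>\<lambda>x. f (j z + x) + k z\<close>, it is convex
  (\<open>midpoint_convex_dominated_imp_convex\<close>).

  If \<open>g 0\<close>, the infimum of \<open>f \<circ> j + k\<close>, is finite, then \<open>g\<close> is finite everywhere, and by the
  Hahn--Banach theorem it has a subgradient \<open>L\<close> at \<open>0\<close> (\<open>convex_subgradient_exists\<close>). The
  inequality \<open>g 0 + L x \<le> f (j z + x) + k z\<close>, read with \<open>y = j z + x\<close>, becomes
  \<open>L y + (g 0 - k z - L (j z)) \<le> f y\<close>, so the supremum \<open>c\<close> over \<open>z\<close> of the bracket is finite
  and \<open>A = L + c\<close> satisfies both \<open>A \<le> f\<close> and \<open>A (j z) + k z \<ge> g 0\<close>. Since \<open>A \<le> f\<close> also gives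
  \<open>A \<circ> j + k \<le> f \<circ> j + k\<close>, the two infima agree. If \<open>f \<circ> j + k\<close> is unbounded below, every affine
  minorant of \<open>f\<close> serves, and one comes from a subgradient of \<open>f\<close>.
\<close>

section \<open>Infima of families of functions\<close>

text \<open>
  This one estimate yields the convexity of every infimum formed below: of a chain of functions,
  of a marginal over a real parameter, and, with \<open>u = v = 1 / 2\<close>, the midpoint convexity of the
  marginal over \<open>Z\<close>.
\<close>

lemma INF_combination_le:
  fixes F :: "'i \<Rightarrow> 'b \<Rightarrow> real"
  assumes "I \<noteq> {}" and bdd: "\<And>x. bdd_below ((\<lambda>i. F i x) ` I)"
    and "0 \<le> u" "0 \<le> v" "u + v = 1"
    and comb: "\<And>i1 i2. i1 \<in> I \<Longrightarrow> i2 \<in> I \<Longrightarrow> \<exists>i\<in>I. F i z \<le> u * F i1 x + v * F i2 y"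
  shows "(INF i\<in>I. F i z) \<le> u * (INF i\<in>I. F i x) + v * (INF i\<in>I. F i y)"
proof (rule field_le_epsilon)
  fix e :: real assume "e > 0"
  obtain i1 where i1: "i1 \<in> I" "F i1 x < (INF i\<in>I. F i x) + e"
    using cINF_less_iff[OF \<open>I \<noteq> {}\<close> bdd[of x], of "(INF i\<in>I. F i x) + e"] \<open>e > 0\<close> by auto
  obtain i2 where i2: "i2 \<in> I" "F i2 y < (INF i\<in>I. F i y) + e"
    using cINF_less_iff[OF \<open>I \<noteq> {}\<close> bdd[of y], of "(INF i\<in>I. F i y) + e"] \<open>e > 0\<close> by auto
  obtain i where i: "i \<in> I" "F i z \<le> u * F i1 x + v * F i2 y"
    using comb[OF i1(1) i2(1)] by blast
  have "(INF i\<in>I. F i z) \<le> F i z"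
    using bdd i(1) by (rule cINF_lower)
  also note i(2)
  also have "u * F i1 x + v * F i2 y \<le> u * ((INF i\<in>I. F i x) + e) + v * ((INF i\<in>I. F i y) + e)"
    using i1(2) i2(2) assms(3,4) by (intro add_mono mult_left_mono) auto
  also have "\<dots> = u * (INF i\<in>I. F i x) + v * (INF i\<in>I. F i y) + (u + v) * e"
    by (simp add: algebra_simps)
  finally show "(INF i\<in>I. F i z) \<le> u * (INF i\<in>I. F i x) + v * (INF i\<in>I. F i y) + e"
    using assms(5) by simp
qed

section \<open>Subgradients of convex functions\<close>

text \<open>
  Zorn's lemma. A chain has a lower bound because convexity and \<open>q 0 = 0\<close> force
  \<open>q x \<ge> - q (- x) \<ge> - g (- x)\<close>, so its pointwise infimum is finite.
\<close>

lemma minimal_convex_minorant_exists: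
  fixes g :: "'a::real_vector \<Rightarrow> real"
  assumes "convex_on UNIV g" and "g 0 = 0"
  obtains q where "convex_on UNIV q" "q 0 = 0" "\<And>x. q x \<le> g x"
    and "\<And>r. convex_on UNIV r \<Longrightarrow> r 0 = 0 \<Longrightarrow> (\<And>x. r x \<le> q x) \<Longrightarrow> r = q"
proof -
  define Q where "Q = {q. convex_on UNIV q \<and> q 0 = 0 \<and> (\<forall>x. q x \<le> g x)}"
  define P where "P = (\<lambda>q r :: 'a \<Rightarrow> real. \<forall>x. r x \<le> q x)"
  have "\<exists>m\<in>Q. \<forall>a\<in>Q. P m a \<longrightarrow> a = m"
  proof (rule predicate_Zorn)
    show "partial_order_on Q (relation_of P Q)"
      by (rule partial_order_on_relation_ofI)
         (auto simp: P_def fun_eq_iff intro: order_trans order_antisym)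
  next
    fix C assume C: "C \<in> Chains (relation_of P Q)"
    have CQ: "C \<subseteq> Q" and chain: "\<And>a b. a \<in> C \<Longrightarrow> b \<in> C \<Longrightarrow> P a b \<or> P b a"
      using C unfolding Chains_def relation_of_def by auto
    show "\<exists>u\<in>Q. \<forall>a\<in>C. P a u"
    proof (cases "C = {}")
      case True
      then show ?thesis using assms by (auto simp: Q_def)
    next
      case False
      have bdd: "bdd_below ((\<lambda>q. q x) ` C)" for x
      proof (rule bdd_belowI2)
        fix q assume "q \<in> C"
        then have q: "convex_on UNIV q" "q 0 = 0" "q (- x) \<le> g (- x)"
          using CQ by (auto simp: Q_def)
        have "q ((1/2) *\<^sub>R x + (1/2) *\<^sub>R (- x)) \<le> (1/2) * q x + (1/2) * q (- x)"
          using q(1) unfolding convex_on_def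
            by (meson UNIV_I field_sum_of_halves half_gt_zero less_imp_le zero_less_one)
        then show "- g (- x) \<le> q x"
          using q by simp
      qed
      define m where "m x = (INF q\<in>C. q x)" for x
      have m_le: "m x \<le> q x" if "q \<in> C" for q x
        unfolding m_def using bdd that by (rule cINF_lower)
      have "convex_on UNIV m"
        unfolding convex_on_def m_def
      proof (intro conjI ballI allI impI INF_combination_le[OF False bdd])
        fix x y :: 'a and u v :: real and q r
        assume uv: "0 \<le> u" "0 \<le> v" "u + v = 1" and qr: "q \<in> C" "r \<in> C"
        have conv: "p (u *\<^sub>R x + v *\<^sub>R y) \<le> u * p x + v * p y" if "p \<in> C" for p
          using that CQ uv by (auto simp: Q_def convex_on_def)
        \<comment> \<open>The smaller of the two members of the chain works.\<close>
        from chain[OF qr]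
        show "\<exists>p\<in>C. p (u *\<^sub>R x + v *\<^sub>R y) \<le> u * q x + v * r y"
        proof
          assume "P q r"
          then have "u * r x \<le> u * q x"
            using uv by (auto simp: P_def intro: mult_left_mono)
          then show ?thesis using conv[OF qr(2)] qr(2) by (intro bexI[of _ r]) auto
        next
          assume "P r q"
          then have "v * q y \<le> v * r y"
            using uv by (auto simp: P_def intro: mult_left_mono)
          then show ?thesis using conv[OF qr(1)] qr(1) by (intro bexI[of _ q]) auto
        qed
      qed auto
      moreover have "m 0 = 0"
      proof -
        have "(\<lambda>q. q 0) ` C = {0}" using CQ False by (auto simp: Q_def)
        then show ?thesis by (simp add: m_def)
      qed
      moreover have "m x \<le> g x" for x
      proof -
        obtain q where "q \<in> C" using False by blast
        with m_le[OF this, of x] CQ show ?thesis by (force simp: Q_def intro: order_trans)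
      qed
      ultimately show ?thesis
        using m_le by (auto simp: Q_def P_def intro!: bexI[of _ m])
    qed
  qed
  then obtain q where q: "q \<in> Q" "\<And>r. r \<in> Q \<Longrightarrow> P q r \<Longrightarrow> r = q" by blast
  show thesis
  proof (rule that[of q])
    fix r :: "'a \<Rightarrow> real" assume "convex_on UNIV r" "r 0 = 0" "\<And>x. r x \<le> q x"
    moreover from this(3) q(1) have "\<And>x. r x \<le> g x"
      by (force simp: Q_def intro: order_trans)
    ultimately show "r = q" using q(2)[of r] by (auto simp: Q_def P_def)
  qed (use q(1) in \<open>auto simp: Q_def\<close>)
qed

text \<open>
  Two modifications that can only lower \<open>q\<close>, and so must leave it unchanged, give linearity:
  \<open>\<lambda>x. q (s x) / s\<close> for \<open>0 < s \<le> 1\<close> gives positive homogeneity, and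
  \<open>\<lambda>x. INF t\<ge>0. q (x + t y) - t q y\<close> gives \<open>q x \<le> q (x + y) - q y\<close>, the reverse of
  subadditivity.
\<close>

lemma minimal_convex_imp_linear:
  fixes q :: "'a::real_vector \<Rightarrow> real"
  assumes q: "convex_on UNIV q" "q 0 = 0"
    and minimal: "\<And>r. convex_on UNIV r \<Longrightarrow> r 0 = 0 \<Longrightarrow> (\<And>x. r x \<le> q x) \<Longrightarrow> r = q"
  shows "linear q"
proof -
  have conv: "q (u *\<^sub>R x + v *\<^sub>R y) \<le> u * q x + v * q y"
    if "0 \<le> u" "0 \<le> v" "u + v = 1" for u v x y
    using q(1) that by (auto simp: convex_on_def)
  have shrink: "q (s *\<^sub>R x) = s * q x" if s: "0 < s" "s \<le> 1" for s x
  proof -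
    have "(\<lambda>x. q (s *\<^sub>R x) / s) = q"
    proof (rule minimal)
      show "convex_on UNIV (\<lambda>x. q (s *\<^sub>R x) / s)"
        unfolding convex_on_def
      proof (intro conjI ballI allI impI)
        fix x y :: 'a and u v :: real
        assume "0 \<le> u" "0 \<le> v" "u + v = 1"
        from conv[OF this, of "s *\<^sub>R x" "s *\<^sub>R y"] s
        show "q (s *\<^sub>R (u *\<^sub>R x + v *\<^sub>R y)) / s \<le> u * (q (s *\<^sub>R x) / s) + v * (q (s *\<^sub>R y) / s)"
          by (simp add: field_simps scaleR_add_right)
      qed simp
      show "q (s *\<^sub>R x) / s \<le> q x" for x
        using conv[of "1 - s" s 0 x] s q(2) by (simp add: field_simps)
    qed (use q(2) in simp)
    then have "q (s *\<^sub>R x) / s = q x" by (rule fun_cong)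
    then show ?thesis using s by (simp add: field_simps)
  qed
  have homog: "q (t *\<^sub>R x) = t * q x" if "0 \<le> t" for t x
  proof (cases "t \<le> 1")
    case True
    then show ?thesis using that shrink[of t x] q(2) by (cases "t = 0") auto
  next
    case False
    then show ?thesis using shrink[of "1 / t" "t *\<^sub>R x"] by (simp add: field_simps)
  qed
  have subadd: "q (x + y) \<le> q x + q y" for x y
    using conv[of "1/2" "1/2" x y] shrink[of "1/2" "x + y"] by (simp add: scaleR_add_right)
  have superadd: "q x + q y \<le> q (x + y)" for x y
  proof -
    define F where "F t x = q (x + t *\<^sub>R y) - t * q y" for t x
    have bdd: "bdd_below ((\<lambda>t. F t x) ` {0..})" for x
    proof (rule bdd_belowI2)
      fix t :: real assume "t \<in> {0..}"
      then show "- q (- x) \<le> F t x"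
        using subadd[of "- x" "x + t *\<^sub>R y"] homog[of t y] by (simp add: F_def)
    qed
    have low: "(INF t\<in>{0..}. F t x) \<le> F t x" if "0 \<le> t" for t x
      by (rule cINF_lower[OF bdd]) (use that in auto)
    have "(\<lambda>x. INF t\<in>{0..}. F t x) = q"
    proof (rule minimal)
      show "convex_on UNIV (\<lambda>x. INF t\<in>{0..}. F t x)"
        unfolding convex_on_def
      proof (intro conjI ballI allI impI INF_combination_le[OF _ bdd])
        fix x x' :: 'a and u v t t' :: real
        assume uv: "0 \<le> u" "0 \<le> v" "u + v = 1" and t: "t \<in> {0..}" "t' \<in> {0..}"
        have "F (u * t + v * t') (u *\<^sub>R x + v *\<^sub>R x') \<le> u * F t x + v * F t' x'"
          using conv[OF uv, of "x + t *\<^sub>R y" "x' + t' *\<^sub>R y"]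
          by (simp add: F_def algebra_simps)
        then show "\<exists>s\<in>{0..}. F s (u *\<^sub>R x + v *\<^sub>R x') \<le> u * F t x + v * F t' x'"
          using uv t by (intro bexI[of _ "u * t + v * t'"]) auto
      qed auto
      have "(\<lambda>t. F t 0) ` {0..} = {0}"
        by (auto simp: F_def homog)
      then show "(INF t\<in>{0..}. F t 0) = 0" by simp
      show "(INF t\<in>{0..}. F t x) \<le> q x" for x
        using low[of 0 x] by (simp add: F_def)
    qed
    from fun_cong[OF this, of x] low[of 1 x] show ?thesis
      by (simp add: F_def)
  qed
  have add: "q (x + y) = q x + q y" for x y
    using subadd superadd by (rule order_antisym)
  have minus: "q (- x) = - q x" for x
    using add[of x "- x"] q(2) by simp
  have "q (t *\<^sub>R x) = t * q x" for t x
    using homog[of t x] homog[of "- t" x] minus[of "t *\<^sub>R x"] by (cases "0 \<le> t") auto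
  with add show ?thesis by (intro linearI) auto
qed

lemma convex_subgradient_exists:
  fixes g :: "'a::real_vector \<Rightarrow> real"
  assumes "convex_on UNIV g"
  obtains L where "linear L" "\<And>x. g 0 + L x \<le> g x"
proof (rule minimal_convex_minorant_exists[of "\<lambda>x. g x + - g 0"])
  show "convex_on UNIV (\<lambda>x. g x + - g 0)"
    using assms by (intro convex_on_add) (simp_all add: convex_on_const)
  fix q assume "convex_on UNIV q" "q 0 = 0" and le: "\<And>x. q x \<le> g x + - g 0"
    and min: "\<And>r. convex_on UNIV r \<Longrightarrow> r 0 = 0 \<Longrightarrow> (\<And>x. r x \<le> q x) \<Longrightarrow> r = q"
  show thesis
  proof (rule that[of q])
    show "linear q"
      by (rule minimal_convex_imp_linear) (fact \<open>convex_on UNIV q\<close> \<open>q 0 = 0\<close> min)+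
    show "g 0 + q x \<le> g x" for x using le[of x] by simp
  qed
qed simp

section \<open>Midpoint convexity and directions of recession\<close>

text \<open>
  On a segment, let \<open>\<phi>\<close> be \<open>g\<close> minus its chord. It is midpoint convex, vanishes at both
  endpoints and is bounded above because \<open>h\<close> is. Each \<open>t\<close> is the midpoint of an endpoint and
  another point of the segment, so an upper bound \<open>M\<close> of \<open>\<phi>\<close> improves to \<open>M / 2\<close>,
  and hence to \<open>0\<close>.
\<close>

lemma midpoint_convex_dominated_imp_convex:
  fixes g h :: "'a::real_vector \<Rightarrow> real"
  assumes mid: "\<And>x y. g ((1/2) *\<^sub>R x + (1/2) *\<^sub>R y) \<le> (1/2) * g x + (1/2) * g y"
    and h: "convex_on UNIV h" and le: "\<And>x. g x \<le> h x"
  shows "convex_on UNIV g"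
proof (rule convex_onI)
  fix t :: real and x y :: 'a
  assume t: "0 < t" "t < 1"
  define p where "p s = (1 - s) *\<^sub>R x + s *\<^sub>R y" for s
  define \<phi> where "\<phi> s = g (p s) - ((1 - s) * g x + s * g y)" for s
  define M where "M = \<bar>h x\<bar> + \<bar>h y\<bar> + \<bar>g x\<bar> + \<bar>g y\<bar>"
  have \<phi>_M: "\<phi> s \<le> M" if s: "0 \<le> s" "s \<le> 1" for s
  proof -
    have bound: "\<bar>c * a\<bar> \<le> \<bar>a\<bar>" if "0 \<le> c" "c \<le> 1" for a c :: real
      using that by (simp add: abs_mult mult_left_le_one_le)
    have "g (p s) \<le> (1 - s) * h x + s * h y"
      unfolding p_def using le convex_onD[OF h s] by (meson UNIV_I order_trans)
    then show ?thesis
      using bound[of s "h y"] bound[of "1 - s" "h x"] bound[of s "g y"] bound[of "1 - s" "g x"] s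
      unfolding \<phi>_def M_def by linarith
  qed
  have \<phi>_mid: "\<phi> ((1/2) * a + (1/2) * b) \<le> (1/2) * \<phi> a + (1/2) * \<phi> b" for a b
  proof -
    have "1 - ((1/2) * a + (1/2) * b) = (1/2) * (1 - a) + (1/2) * (1 - b)"
      by (simp add: field_simps)
    then have "p ((1/2) * a + (1/2) * b) = (1/2) *\<^sub>R p a + (1/2) *\<^sub>R p b"
      unfolding p_def by (simp only: scaleR_add_left scaleR_add_right scaleR_scaleR) simp
    then show ?thesis
      using mid[of "p a" "p b"] by (simp add: \<phi>_def field_simps)
  qed
  have \<phi>_ends: "\<phi> 0 = 0" "\<phi> 1 = 0" by (simp_all add: \<phi>_def p_def)
  have pow: "\<forall>s. 0 \<le> s \<and> s \<le> 1 \<longrightarrow> \<phi> s \<le> M * (1/2) ^ n" for n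
  proof (induction n)
    case 0
    then show ?case using \<phi>_M by simp
  next
    case (Suc n)
    show ?case
    proof (intro allI impI)
      fix s :: real assume s: "0 \<le> s \<and> s \<le> 1"
      have "\<phi> s \<le> (1/2) * (M * (1/2) ^ n)"
      proof (cases "s \<le> 1/2")
        case True
        then have "\<phi> (2 * s) \<le> M * (1/2) ^ n" using Suc s by auto
        then show ?thesis using \<phi>_mid[of "2 * s" 0] \<phi>_ends by simp
      next
        case False
        then have "\<phi> (2 * s - 1) \<le> M * (1/2) ^ n" using Suc s by auto
        moreover have "(1/2) * (2 * s - 1) + (1/2) * 1 = s" by (simp add: field_simps)
        ultimately show ?thesis using \<phi>_mid[of "2 * s - 1" 1] \<phi>_ends by simp
      qed
      then show "\<phi> s \<le> M * (1/2) ^ Suc n" by simp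
    qed
  qed
  have "(\<lambda>n. M * (1/2) ^ n) \<longlonglongrightarrow> M * 0"
    by (intro tendsto_intros LIMSEQ_power_zero) auto
  then have "\<phi> t \<le> M * 0"
    by (rule LIMSEQ_le_const) (use pow t in auto)
  then show "g ((1 - t) *\<^sub>R x + t *\<^sub>R y) \<le> (1 - t) * g x + t * g y"
    by (simp add: \<phi>_def p_def)
qed simp

text \<open>
  Approach \<open>x + w\<close> by going almost nowhere towards a far away point:
  \<open>x + w = (1 - e) x + e (x + w / e)\<close>. The far point is the midpoint of \<open>2 x\<close> and \<open>(2 / e) w\<close>, and
  \<open>f\<close> is controlled at the latter by the hypothesis with \<open>\<rho> = 2 / e\<close>. The error is \<open>O(e)\<close>.
\<close>

lemma convex_recession_any_point:
  fixes f :: "'a::real_vector \<Rightarrow> real"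
  assumes f: "convex_on UNIV f"
    and rec: "\<And>\<rho>. 0 \<le> \<rho> \<Longrightarrow> f (\<rho> *\<^sub>R w) + \<rho> * s \<le> f 0"
  shows "f (x + w) + s \<le> f x"
proof -
  define D where "D = (1/2) * f (2 *\<^sub>R x) + (1/2) * f 0 - f x"
  have bound: "f (x + w) + s \<le> f x + e * D" if e: "0 < e" "e < 1" for e
  proof -
    have "(1 - 1/2) *\<^sub>R (2 *\<^sub>R x) + (1/2) *\<^sub>R ((2 / e) *\<^sub>R w) = x + (1 / e) *\<^sub>R w"
      by simp
    then have "f (x + (1 / e) *\<^sub>R w) \<le> (1/2) * f (2 *\<^sub>R x) + (1/2) * f ((2 / e) *\<^sub>R w)"
      using convex_onD[OF f, of "1/2" "2 *\<^sub>R x" "(2 / e) *\<^sub>R w"] by simp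
    also have "\<dots> \<le> (1/2) * f (2 *\<^sub>R x) + (1/2) * (f 0 - (2 / e) * s)"
      using rec[of "2 / e"] e by simp
    finally have far: "f (x + (1 / e) *\<^sub>R w) \<le> (1/2) * f (2 *\<^sub>R x) + (1/2) * (f 0 - (2 / e) * s)" .
    have "(1 - e) *\<^sub>R x + e *\<^sub>R (x + (1 / e) *\<^sub>R w) = x + w"
      using e by (simp add: algebra_simps)
    then have "f (x + w) \<le> (1 - e) * f x + e * f (x + (1 / e) *\<^sub>R w)"
      using convex_onD[OF f, of e x "x + (1 / e) *\<^sub>R w"] e by simp
    also have "\<dots> \<le> (1 - e) * f x + e * ((1/2) * f (2 *\<^sub>R x) + (1/2) * (f 0 - (2 / e) * s))"
      using far e by simp
    also have "\<dots> = f x + e * D - s"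
      using e by (simp add: D_def field_simps)
    finally show ?thesis by simp
  qed
  have "((\<lambda>e. f x + e * D) \<longlongrightarrow> f x + 0 * D) (at_right 0)"
    by (intro tendsto_intros)
  moreover have "eventually (\<lambda>e. f (x + w) + s \<le> f x + e * D) (at_right 0)"
    using bound by (auto simp: eventually_at_right_field intro!: exI[of _ 1])
  ultimately have "f (x + w) + s \<le> f x + 0 * D"
    by (rule tendsto_lowerbound) simp
  then show ?thesis by simp
qed

section \<open>The affine minorant\<close>

text \<open>
  The assumption on \<open>z1\<close> and \<open>z2\<close> is midpoint convexity of the marginal, in the form it has before the
  infima are taken. The affine map comes from a subgradient of the marginal at \<open>0\<close>: its linear
  part is the subgradient, its constant the least one that keeps \<open>b \<le> A (j z) + k z\<close> with
  \<open>b\<close> raised to the infimum \<open>g 0\<close>.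
\<close>

lemma affine_minorant_if_bounded_below:
  fixes f :: "'a::real_vector \<Rightarrow> real" and j :: "'z \<Rightarrow> 'a" and k :: "'z \<Rightarrow> real"
  assumes f: "convex_on UNIV f" and Z: "Z \<noteq> {}"
    and mid: "\<And>z1 z2 x1 x2. z1 \<in> Z \<Longrightarrow> z2 \<in> Z \<Longrightarrow>
      \<exists>z\<in>Z. f (j z + ((1/2) *\<^sub>R x1 + (1/2) *\<^sub>R x2)) + k z
        \<le> (1/2) * (f (j z1 + x1) + k z1) + (1/2) * (f (j z2 + x2) + k z2)"
    and low: "\<And>z. z \<in> Z \<Longrightarrow> b \<le> f (j z) + k z"
  obtains A where "affine_map A" "\<And>x. A x \<le> f x" "\<And>z. z \<in> Z \<Longrightarrow> b \<le> A (j z) + k z"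
proof -
  define F where "F z x = f (j z + x) + k z" for z x
  define g where "g x = (INF z\<in>Z. F z x)" for x
  obtain z0 where z0: "z0 \<in> Z" using Z by blast
  have bdd: "bdd_below ((\<lambda>z. F z x) ` Z)" for x
  proof (rule bdd_belowI2)
    fix z assume "z \<in> Z"
    \<comment> \<open>The points \<open>x\<close> and \<open>- x\<close> have midpoint \<open>0\<close>, where \<open>b\<close> is a lower bound.\<close>
    from mid[OF this z0, of x "- x"] obtain z' where "z' \<in> Z"
      "F z' 0 \<le> (1/2) * F z x + (1/2) * F z0 (- x)"
      by (auto simp: F_def)
    with low[of z'] show "2 * b - F z0 (- x) \<le> F z x" by (simp add: F_def field_simps)
  qed
  have g_le: "g x \<le> F z x" if "z \<in> Z" for z x
    unfolding g_def using bdd that by (rule cINF_lower)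
  have "convex_on UNIV g"
  proof (rule midpoint_convex_dominated_imp_convex)
    show "g ((1/2) *\<^sub>R x + (1/2) *\<^sub>R y) \<le> (1/2) * g x + (1/2) * g y" for x y
      unfolding g_def by (rule INF_combination_le[OF Z bdd]) (use mid in \<open>auto simp: F_def\<close>)
    show "convex_on UNIV (F z0)"
      unfolding convex_on_def
    proof (intro conjI ballI allI impI)
      fix x y :: 'a and u v :: real
      assume uv: "0 \<le> u" "0 \<le> v" "u + v = 1"
      then have v: "v = 1 - u" by simp
      have "u *\<^sub>R (j z0 + x) + v *\<^sub>R (j z0 + y) = j z0 + (u *\<^sub>R x + v *\<^sub>R y)"
        unfolding v by (simp add: algebra_simps)
      moreover have "f (u *\<^sub>R (j z0 + x) + v *\<^sub>R (j z0 + y)) \<le> u * f (j z0 + x) + v * f (j z0 + y)"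
        using f uv by (auto simp: convex_on_def)
      ultimately show "F z0 (u *\<^sub>R x + v *\<^sub>R y) \<le> u * F z0 x + v * F z0 y"
        unfolding v by (simp add: F_def algebra_simps)
    qed simp
    show "g x \<le> F z0 x" for x using z0 by (rule g_le)
  qed
  then obtain L where L: "linear L" "\<And>x. g 0 + L x \<le> g x"
    by (rule convex_subgradient_exists) blast
  define c where "c = (SUP z\<in>Z. g 0 - k z - L (j z))"
  have key: "g 0 - k z - L (j z) \<le> f y - L y" if "z \<in> Z" for z y
    using L(2)[of "y - j z"] g_le[OF that, of "y - j z"]
    by (simp add: F_def linear_diff[OF L(1)])
  have bdd': "bdd_above ((\<lambda>z. g 0 - k z - L (j z)) ` Z)"
    using key[of _ 0] by (intro bdd_aboveI2)
  have "b \<le> g 0"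
    unfolding g_def using low by (intro cINF_greatest[OF Z]) (simp add: F_def)
  show thesis
  proof (rule that[of "\<lambda>x. L x + c"])
    show "affine_map (\<lambda>x. L x + c)"
      using L(1) by (auto simp: affine_map_def)
    show "L x + c \<le> f x" for x
    proof -
      have "c \<le> f x - L x" unfolding c_def using key by (rule cSUP_least[OF Z])
      then show ?thesis by simp
    qed
    show "b \<le> L (j z) + c + k z" if "z \<in> Z" for z
    proof -
      have "g 0 - k z - L (j z) \<le> c" unfolding c_def using bdd' that by (intro cSUP_upper)
      with \<open>b \<le> g 0\<close> show ?thesis by simp
    qed
  qed
qed

theorem theorem6p1:
  fixes f :: "'a::real_vector \<Rightarrow> real"
    and Z :: "'z set"
    and j :: "'z \<Rightarrow> 'a"
    and k :: "'z \<Rightarrow> real"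
  assumes "convex_on UNIV f"
    and "Z \<noteq> {}"
    and "\<And>z1 z2. z1 \<in> Z \<Longrightarrow> z2 \<in> Z \<Longrightarrow>
      \<exists>z\<in>Z. \<forall>\<rho>::real. 0 \<le> \<rho> \<longrightarrow>
        f (\<rho> *\<^sub>R (j z - (1/2) *\<^sub>R j z1 - (1/2) *\<^sub>R j z2))
          + \<rho> * (k z - (1/2) * k z1 - (1/2) * k z2) \<le> f 0"
  shows "\<exists>A :: 'a \<Rightarrow> real. affine_map A \<and> (\<forall>x. A x \<le> f x) \<and>
    (INF z\<in>Z. ereal (A (j z) + k z)) = (INF z\<in>Z. ereal (f (j z) + k z))"
proof -
  define B where "B = (INF z\<in>Z. ereal (f (j z) + k z))"
  have B_le: "B \<le> ereal (f (j z) + k z)" if "z \<in> Z" for z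
    unfolding B_def using that by (rule INF_lower)
  have upper: "(INF z\<in>Z. ereal (A (j z) + k z)) \<le> B" if "\<And>x. A x \<le> f x" for A
    unfolding B_def using that by (intro INF_mono') simp
  have "\<exists>A. affine_map A \<and> (\<forall>x. A x \<le> f x) \<and> B \<le> (INF z\<in>Z. ereal (A (j z) + k z))"
  proof (cases B)
    case (real b)
    have mid: "\<exists>z\<in>Z. f (j z + ((1/2) *\<^sub>R x1 + (1/2) *\<^sub>R x2)) + k z
        \<le> (1/2) * (f (j z1 + x1) + k z1) + (1/2) * (f (j z2 + x2) + k z2)"
      if z12: "z1 \<in> Z" "z2 \<in> Z" for z1 z2 x1 x2
    proof -
      obtain z where z: "z \<in> Z" and rec: "\<And>\<rho>. 0 \<le> \<rho> \<Longrightarrow>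
          f (\<rho> *\<^sub>R (j z - (1/2) *\<^sub>R j z1 - (1/2) *\<^sub>R j z2))
            + \<rho> * (k z - (1/2) * k z1 - (1/2) * k z2) \<le> f 0"
        using assms(3)[OF z12] by blast
      let ?m = "(1/2) *\<^sub>R (j z1 + x1) + (1/2) *\<^sub>R (j z2 + x2)"
      have "?m + (j z - (1/2) *\<^sub>R j z1 - (1/2) *\<^sub>R j z2) = j z + ((1/2) *\<^sub>R x1 + (1/2) *\<^sub>R x2)"
        by (simp add: algebra_simps)
      then have "f (j z + ((1/2) *\<^sub>R x1 + (1/2) *\<^sub>R x2)) + (k z - (1/2) * k z1 - (1/2) * k z2) \<le> f ?m"
        using convex_recession_any_point[OF assms(1) rec, of ?m] by (simp only:)
      moreover have "f ?m \<le> (1/2) * f (j z1 + x1) + (1/2) * f (j z2 + x2)"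
        using convex_onD[OF assms(1), of "1/2" "j z1 + x1" "j z2 + x2"] by simp
      ultimately show ?thesis using z by (intro bexI[of _ z]) (simp_all add: algebra_simps)
    qed
    have "b \<le> f (j z) + k z" if "z \<in> Z" for z
      using B_le[OF that] real by simp
    then obtain A where "affine_map A" "\<And>x. A x \<le> f x" "\<And>z. z \<in> Z \<Longrightarrow> b \<le> A (j z) + k z"
      using affine_minorant_if_bounded_below[where f=f and Z=Z and j=j and k=k and b=b]
        assms(1,2) mid by blast
    then show ?thesis using real by (intro exI[of _ A]) (auto intro: INF_greatest)
  next
    case PInf
    then show ?thesis using assms(2) B_le by force
  next
    case MInf
    obtain L where "linear L" "\<And>x. f 0 + L x \<le> f x"
      using convex_subgradient_exists[OF assms(1)] by blast
    then show ?thesis using MInf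
      by (intro exI[of _ "\<lambda>x. L x + f 0"]) (auto simp: affine_map_def add.commute)
  qed
  then show ?thesis
    using upper unfolding B_def by (meson order_antisym)
qed

end
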